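(* Let $G$ be a simple connected graph with $n(G)\ge 4$ vertices and clique number $\omega(G)<4$ (i.e., $G$ contains no $K_4$). Then \[ \dim_l(G)\le \left\lfloor \frac{n(G)}{2}\right\rfloor . \]
   Context: For a graph $G$, $n(G)$ denotes its number of vertices and $\omega(G)$ its clique number (the largest order of a complete subgraph). $d_G(u,v)$ is the length of a shortest $u,v$-path. A vertex $w$ distinguishes vertices $u,v$ if $d_G(u,w)\neq d_G(v,w)$. A subset $W\subseteq V(G)$ is a local resolving set of $G$ if for every pair of adjacent vertices $u,v\in V(G)\setminus W$ there is a vertex $w\in W$ distinguishing $u$ and $v$. The local metric dimension $\dim_l(G)$ is the minimum cardinality of a local resolving set of $G$. *)

theory Defs
  imports "Graph_Theory.Graph_Theory"
begin

text \<open>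
  A finite simple graph is a \<open>graph\<close> in the sense of the Graph_Theory library: finite,
  loop-free, without parallel arcs, each edge being represented by a pair of opposite arcs.
\<close>

text \<open>Only meaningful if there is a path between the two vertices, as in a connected graph.\<close>

definition graph_dist :: "('a,'b) pre_digraph \<Rightarrow> 'a \<Rightarrow> 'a \<Rightarrow> nat" where
  "graph_dist G u v = (LEAST k. \<exists>p. pre_digraph.apath G u p v \<and> length p = k)"

definition clique_number :: "('a,'b) pre_digraph \<Rightarrow> nat" where
  "clique_number G = Max {k. \<exists>H. subgraph H G \<and> complete_digraph k H}"

definition distinguishes :: "('a,'b) pre_digraph \<Rightarrow> 'a \<Rightarrow> 'a \<Rightarrow> 'a \<Rightarrow> bool" where
  "distinguishes G w u v \<longleftrightarrow> graph_dist G u w \<noteq> graph_dist G v w"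

definition local_resolving_set :: "('a,'b) pre_digraph \<Rightarrow> 'a set \<Rightarrow> bool" where
  "local_resolving_set G W \<longleftrightarrow> W \<subseteq> verts G \<and>
     (\<forall>u \<in> verts G - W. \<forall>v \<in> verts G - W. u \<rightarrow>\<^bsub>G\<^esub> v \<longrightarrow> (\<exists>w \<in> W. distinguishes G w u v))"

definition local_metric_dimension :: "('a,'b) pre_digraph \<Rightarrow> nat" where
  "local_metric_dimension G = Min (card ` {W. local_resolving_set G W})"

end

theory Submission
  imports Defs
begin

text \<open>
  It suffices to find a set \<open>W\<close> of at most half of the vertices such that adjacent vertices
  outside \<open>W\<close> have different neighbourhoods in \<open>W\<close>. Take \<open>W\<close> minimal, first in size, then in the
  number of isolated edges of the graph induced on \<open>W\<close>, then in the sum of the degrees outside \<open>W\<close>.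

  Call \<open>w \<in> W\<close> essential if some edge outside \<open>W\<close> is resolved by \<open>w\<close> alone. If \<open>w\<close> is not
  essential, then, as \<open>W - {w}\<close> is not resolving, some vertex outside \<open>W\<close> has \<open>w\<close> and the
  neighbours of \<open>w\<close> in \<open>W\<close> as its neighbours in \<open>W\<close>. One such vertex can serve two nonessential
  vertices only if these form a critical pair: an isolated edge of \<open>W\<close>, completed to a triangle
  by a vertex \<open>u\<close> outside \<open>W\<close>. Minimality of \<open>W\<close> then yields either an edge that avoids \<open>u\<close> and
  whose ends see \<open>W\<close> identically except for exactly this pair, or a vertex other than \<open>u\<close> that
  sees this pair and no other critical pair.

  The selected edges form a forest outside \<open>W\<close>, since each of them changes the neighbourhood in
  \<open>W\<close> in a place where no other one does. The selected vertices lie in distinct components of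
  this forest: either no selected edge changes whether a vertex in question is seen, or some
  selected edge joins two vertices that both see the same two adjacent vertices of \<open>W\<close>, which
  gives a complete graph on four vertices. As a forest has at
  most as many edges as vertices minus components, \<open>|W| \<le> |V - W|\<close>.
\<close>

section \<open>Counting in forests\<close>

text \<open>Both orientations of the edges of a multigraph whose edges are indexed by
  \<open>D\<close>. The reflexive transitive closure then relates exactly the vertices of a common
  component.\<close>

definition links :: "('d \<Rightarrow> 'a) \<Rightarrow> ('d \<Rightarrow> 'a) \<Rightarrow> 'd set \<Rightarrow> ('a \<times> 'a) set" where
  "links Y Z D = (\<Union>d\<in>D. {(Y d, Z d), (Z d, Y d)})"

lemma sym_links: "sym (links Y Z D)"
  by (auto simp: links_def sym_def)

lemma links_rtrancl_sym: "(a, b) \<in> (links Y Z D)\<^sup>* \<Longrightarrow> (b, a) \<in> (links Y Z D)\<^sup>*"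
  by (rule symD[OF sym_rtrancl[OF sym_links]])

lemma links_rtrancl_invariant:
  assumes "(a, b) \<in> (links Y Z D)\<^sup>*" and "\<And>d. d \<in> D \<Longrightarrow> f (Y d) = f (Z d)"
  shows "f a = f b"
  using assms(1) by induction (auto simp: links_def assms(2))

text \<open>\<open>\<phi> d\<close> is a potential that changes along the edge \<open>d\<close> and
  along no other, so each edge is a bridge; \<open>S\<close> meets every component at most once. The
  induction removes one edge: its component splits, one half is free of \<open>S\<close>, and the
  end in that half can be added to \<open>S\<close>.\<close>

lemma forest_card_le:
  fixes \<phi> :: "'d \<Rightarrow> 'a \<Rightarrow> 'b"
  assumes "finite D" "finite U" "Y ` D \<subseteq> U" "Z ` D \<subseteq> U" "S \<subseteq> U"
    and "\<And>d. d \<in> D \<Longrightarrow> \<phi> d (Y d) \<noteq> \<phi> d (Z d)"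
    and "\<And>d e. d \<in> D \<Longrightarrow> e \<in> D \<Longrightarrow> d \<noteq> e \<Longrightarrow> \<phi> d (Y e) = \<phi> d (Z e)"
    and "\<And>a b. a \<in> S \<Longrightarrow> b \<in> S \<Longrightarrow> (a, b) \<in> (links Y Z D)\<^sup>* \<Longrightarrow> a = b"
  shows "card D + card S \<le> card U"
  using assms
proof (induction D arbitrary: S rule: finite_induct)
  case empty
  then show ?case by (simp add: card_mono)
next
  case (insert d D)
  let ?R = "(links Y Z D)\<^sup>*" and ?R' = "(links Y Z (insert d D))\<^sup>*"
  have sub: "?R \<subseteq> ?R'"
    by (intro rtrancl_mono) (auto simp: links_def)
  have yz: "(Y d, Z d) \<in> ?R'" "(Z d, Y d) \<in> ?R'"
    by (auto simp: links_def)
  have not_conn: "(Y d, Z d) \<notin> ?R"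
  proof
    assume "(Y d, Z d) \<in> ?R"
    then have "\<phi> d (Y d) = \<phi> d (Z d)"
      by (rule links_rtrancl_invariant) (use insert.prems(6) insert.hyps(2) in auto)
    then show False using insert.prems(5) by auto
  qed
  \<comment> \<open>Otherwise \<open>d\<close> would put the two representatives into one component.
    They would then coincide, and the ends of \<open>d\<close> would be connected without
    \<open>d\<close>.\<close>
  have "\<exists>t\<in>{Y d, Z d}. \<forall>s\<in>S. (t, s) \<notin> ?R"
  proof (rule ccontr)
    assume "\<not> ?thesis"
    then obtain s s' where s: "s \<in> S" "(Y d, s) \<in> ?R" "s' \<in> S" "(Z d, s') \<in> ?R"
      by blast
    then have "(s, s') \<in> ?R'"
      using sub yz by (meson links_rtrancl_sym rtrancl_trans subsetD)
    then have "s = s'" using insert.prems(7) s by blast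
    then have "(Y d, Z d) \<in> ?R" using s by (meson links_rtrancl_sym rtrancl_trans)
    then show False using not_conn by blast
  qed
  then obtain t where t: "t \<in> {Y d, Z d}" "\<And>s. s \<in> S \<Longrightarrow> (t, s) \<notin> ?R"
    by blast
  have t_notin: "t \<notin> S" using t(2) by blast
  have "card D + card (insert t S) \<le> card U"
  proof (rule insert.IH)
    show "insert t S \<subseteq> U" using t(1) insert.prems by auto
    fix a b assume "a \<in> insert t S" "b \<in> insert t S" "(a, b) \<in> ?R"
    then show "a = b"
      using t(2) insert.prems(7) sub links_rtrancl_sym by (metis insertE subsetD)
  qed (use insert.prems in auto)
  moreover have "finite S" using insert.prems by (meson finite_subset)
  ultimately show ?case using t_notin insert.hyps by simp
qed


section \<open>Adjacency resolving sets of connected graphs without K4\<close>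

text \<open>The setting is free of arcs and paths: connectedness appears as the cut condition
  \<open>edge_leaving\<close>. In \<open>no_K4\<close> the four vertices are automatically distinct
  by \<open>N_irrefl\<close>.\<close>

locale connected_K4_free =
  fixes V :: "'a set" and N :: "'a \<Rightarrow> 'a set"
  assumes finite_V: "finite V"
    and N_subset: "N v \<subseteq> V"
    and N_sym: "u \<in> N v \<Longrightarrow> v \<in> N u"
    and N_irrefl: "v \<notin> N v"
    and no_K4: "\<lbrakk>b \<in> N a; c \<in> N a; d \<in> N a; c \<in> N b; d \<in> N b; d \<in> N c\<rbrakk> \<Longrightarrow> False"
    and edge_leaving: "\<lbrakk>T \<subseteq> V; T \<noteq> {}; T \<noteq> V\<rbrakk> \<Longrightarrow> \<exists>a\<in>T. \<exists>x\<in>V - T. x \<in> N a"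
    and card_V: "4 \<le> card V"
begin

section \<open>Adjacency resolving sets, critical pairs and the minimal choice\<close>

definition resolving :: "'a set \<Rightarrow> bool" where
  "resolving W \<longleftrightarrow> W \<subseteq> V \<and> (\<forall>y\<in>V - W. \<forall>z\<in>V - W. z \<in> N y \<longrightarrow> N y \<inter> W \<noteq> N z \<inter> W)"

text \<open>The parameter \<open>d\<close> is the exact set of vertices of \<open>W\<close>
  resolving the edge. It will be a singleton for an essential vertex or a critical pair, and later
  serves as the index of a selected edge.\<close>

definition edge_across :: "'a set \<Rightarrow> 'a set \<Rightarrow> 'a \<Rightarrow> 'a \<Rightarrow> bool" where
  "edge_across W d y z \<longleftrightarrow> y \<in> V - W \<and> z \<in> V - W \<and> z \<in> N y \<and> sym_diff (N y \<inter> W) (N z \<inter> W) = d"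

definition essential :: "'a set \<Rightarrow> 'a set" where
  "essential W = {w \<in> W. \<exists>y z. edge_across W {w} y z}"

definition isolated_edges :: "'a set \<Rightarrow> 'a set set" where
  "isolated_edges W = {{a, b} | a b. a \<in> W \<and> b \<in> W \<and> N a \<inter> W = {b} \<and> N b \<inter> W = {a}}"

definition critical :: "'a set \<Rightarrow> 'a \<Rightarrow> 'a set \<Rightarrow> bool" where
  "critical W u c \<longleftrightarrow> c \<subseteq> W - essential W \<and> card c = 2 \<and> u \<in> V - W \<and> N u \<inter> W = c \<and>
     (\<forall>w\<in>c. N w \<inter> W = c - {w})"

text \<open>The lexicographic order is well-founded, so a minimal \<open>W\<close> exists. Its three
  entries rule out, in turn, deleting a nonessential vertex, an exchange that destroys an isolated
  edge, and trading a vertex for one of larger degree.\<close>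

definition optimal :: "'a set \<Rightarrow> bool" where
  "optimal W \<longleftrightarrow> resolving W \<and> (\<forall>W'. resolving W' \<longrightarrow>
     (W', W) \<notin> measures [card, \<lambda>W. card (isolated_edges W), \<lambda>W. \<Sum>v\<in>V - W. card (N v)])"

lemma resolving_V: "resolving V"
  by (simp add: resolving_def)

lemma ex_optimal: "\<exists>W. optimal W"
proof -
  obtain W where "W \<in> Collect resolving" and
    "\<And>W'. (W', W) \<in> measures [card, \<lambda>W. card (isolated_edges W), \<lambda>W. \<Sum>v\<in>V - W. card (N v)]
       \<Longrightarrow> W' \<notin> Collect resolving"
    using wfE_min[OF wf_measures, of V "Collect resolving"] resolving_V by blast
  then show ?thesis unfolding optimal_def by blast
qed

lemma finite_isolated_edges: "W \<subseteq> V \<Longrightarrow> finite (isolated_edges W)"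
  by (rule finite_subset[of _ "Pow V"]) (auto simp: isolated_edges_def finite_V)

lemma isolated_edgesI:
  "\<lbrakk>a \<in> W; b \<in> W; N a \<inter> W = {b}; N b \<inter> W = {a}\<rbrakk> \<Longrightarrow> {a, b} \<in> isolated_edges W"
  unfolding isolated_edges_def by blast

lemma isolated_edgesE:
  assumes "e \<in> isolated_edges W"
  obtains a b where "e = {a, b}" "a \<in> W" "b \<in> W" "N a \<inter> W = {b}" "N b \<inter> W = {a}"
  using assms unfolding isolated_edges_def mem_Collect_eq by (elim exE conjE) (rule that)

text \<open>Together with \<open>edge_across_inter_neq\<close> this makes
  \<open>N v \<inter> d\<close> a potential as required by \<open>forest_card_le\<close>, once the
  index sets are pairwise disjoint.\<close>

lemma edge_across_inter_eq:
  assumes "edge_across W d y z" "c \<subseteq> W" "c \<inter> d = {}"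
  shows "N y \<inter> c = N z \<inter> c"
proof (rule set_eqI)
  fix t
  have "t \<in> c \<Longrightarrow> t \<in> W \<and> t \<notin> sym_diff (N y \<inter> W) (N z \<inter> W)"
    using assms unfolding edge_across_def by auto
  then show "t \<in> N y \<inter> c \<longleftrightarrow> t \<in> N z \<inter> c" by auto
qed

lemma edge_across_inter_neq:
  assumes "edge_across W d y z" "d \<noteq> {}"
  shows "N y \<inter> d \<noteq> N z \<inter> d"
proof
  assume eq: "N y \<inter> d = N z \<inter> d"
  obtain t where t: "t \<in> d" using assms(2) by auto
  then have "t \<in> sym_diff (N y \<inter> W) (N z \<inter> W)" using assms(1) unfolding edge_across_def by simp
  moreover have "t \<in> N y \<longleftrightarrow> t \<in> N z" using eq t by auto
  ultimately show False by auto
qed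

lemma criticalD:
  assumes "critical W u c"
  shows "c \<subseteq> W - essential W" "card c = 2" "u \<in> V - W" "N u \<inter> W = c"
    "w \<in> c \<Longrightarrow> N w \<inter> W = c - {w}"
  using assms by (simp_all add: critical_def)

lemma criticalE:
  assumes "critical W u c"
  obtains w w' where "c = {w, w'}" "w \<noteq> w'" "w \<in> W" "w' \<in> W" "w \<notin> essential W" "w' \<notin> essential W"
    "u \<in> V" "u \<notin> W" "N u \<inter> W = {w, w'}" "N w \<inter> W = {w'}" "N w' \<inter> W = {w}"
proof -
  obtain w w' where c: "c = {w, w'}" "w \<noteq> w'"
    using criticalD(2)[OF assms] by (auto simp: card_2_iff)
  have "N w \<inter> W = {w'}" "N w' \<inter> W = {w}"
    using criticalD(5)[OF assms, of w] criticalD(5)[OF assms, of w'] c by auto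
  then show ?thesis
    using criticalD(1,3,4)[OF assms] c by (intro that[of w w']) simp_all
qed

text \<open>A member of a critical pair determines the pair, since its partner is its only neighbour
  in \<open>W\<close>.\<close>

lemma critical_disjoint:
  assumes "critical W u c" "critical W v d" "c \<noteq> d"
  shows "c \<inter> d = {}"
proof (rule ccontr)
  assume "c \<inter> d \<noteq> {}"
  then obtain t where t: "t \<in> c" "t \<in> d" by auto
  have "c - {t} = d - {t}"
    using criticalD(5)[OF assms(1) t(1)] criticalD(5)[OF assms(2) t(2)] by simp
  then show False using t assms(3) by auto
qed

section \<open>Nonessential vertices\<close>

text \<open>Some edge outside \<open>W - {w}\<close> is unresolved by \<open>W - {w}\<close>. If it
  avoided \<open>w\<close>, it would be resolved by \<open>w\<close> alone and \<open>w\<close>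
  would be essential; so \<open>w\<close> is one end, and the other end is the required
  \<open>u\<close>.\<close>

lemma nonessential_neighbour:
  assumes "optimal W" "w \<in> W" "w \<notin> essential W"
  obtains u where "u \<in> V - W" "N u \<inter> W = insert w (N w \<inter> W)"
proof -
  have res: "resolving W" and WV: "W \<subseteq> V"
    using assms unfolding optimal_def resolving_def by auto
  have "finite W" using WV finite_V finite_subset by blast
  then have "card (W - {w}) < card W" using assms(2) by (meson card_Diff1_less)
  then have "\<not> resolving (W - {w})"
    using assms(1) unfolding optimal_def by auto
  then obtain y z where yz: "y \<in> V - (W - {w})" "z \<in> V - (W - {w})" "z \<in> N y"
    "N y \<inter> (W - {w}) = N z \<inter> (W - {w})"
    using WV unfolding resolving_def by blast
  have w_step: "\<exists>u\<in>V - W. N u \<inter> W = insert w (N w \<inter> W)"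
    if "u \<in> V - (W - {w})" "u \<in> N w" "N w \<inter> (W - {w}) = N u \<inter> (W - {w})" for u
  proof
    show "u \<in> V - W" using that N_irrefl by blast
    show "N u \<inter> W = insert w (N w \<inter> W)"
      using that assms(2) N_sym[of u w] N_irrefl[of w] by blast
  qed
  consider "y = w" | "z = w" | "y \<noteq> w" "z \<noteq> w" by blast
  then have "\<exists>u\<in>V - W. N u \<inter> W = insert w (N w \<inter> W)"
  proof cases
    case 1
    then show ?thesis using yz w_step[of z] by auto
  next
    case 2
    then show ?thesis using yz w_step[of y] N_sym[of z y] by auto
  next
    case 3
    then have "y \<in> V - W" "z \<in> V - W" using yz by auto
    moreover from this have "N y \<inter> W \<noteq> N z \<inter> W"
      using res yz(3) unfolding resolving_def by blast
    ultimately have "edge_across W {w} y z"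
      using yz(3,4) unfolding edge_across_def by blast
    then show ?thesis using assms(2,3) unfolding essential_def by blast
  qed
  then show ?thesis using that by blast
qed

text \<open>The two descriptions of what \<open>u\<close> sees force \<open>w\<close>,
  \<open>w'\<close>, \<open>u\<close> to be a triangle. Any further vertex of \<open>W\<close> seen
  by \<open>u\<close> would be adjacent to all three and complete a forbidden clique.\<close>

lemma nonessential_twins_critical:
  assumes "w \<in> W - essential W" "w' \<in> W - essential W" "w \<noteq> w'" "u \<in> V - W"
    and "N u \<inter> W = insert w (N w \<inter> W)" "N u \<inter> W = insert w' (N w' \<inter> W)"
  shows "critical W u {w, w'}"
proof -
  have eq: "insert w (N w \<inter> W) = insert w' (N w' \<inter> W)" using assms(5,6) by simp
  have "w' \<in> insert w (N w \<inter> W)" unfolding eq by simp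
  moreover have "w \<in> N u \<inter> W" unfolding assms(5) by simp
  moreover have "w' \<in> N u \<inter> W" unfolding assms(6) by simp
  ultimately have adj: "w' \<in> N w" "w \<in> N u" "w' \<in> N u" using assms(3) by auto
  have only: "N u \<inter> W = {w, w'}"
  proof (rule ccontr)
    assume "N u \<inter> W \<noteq> {w, w'}"
    then obtain t where t: "t \<in> N u" "t \<in> W" "t \<noteq> w" "t \<noteq> w'"
      using adj assms(1,2) by blast
    then have "t \<in> insert w (N w \<inter> W)" "t \<in> insert w' (N w' \<inter> W)"
      using assms(5,6) by (metis IntI)+
    then have "t \<in> N w" "t \<in> N w'" using t by auto
    with adj t show False using no_K4[of w u w' t] by auto
  qed
  have "N w \<inter> W = {w'}" "N w' \<inter> W = {w}"
    using only assms(3,5,6) N_irrefl[of w] N_irrefl[of w'] by auto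
  moreover have "card {w, w'} = 2" "{w, w'} - {w} = {w'}" "{w, w'} - {w'} = {w}" using assms(3) by auto
  ultimately show ?thesis using only assms(1,2,4) by (simp add: critical_def)
qed

section \<open>Exchanges at a critical triangle\<close>

text \<open>The three vertices of a critical triangle play the same role here: which one is kept
  only depends on the neighbours of \<open>x\<close>.\<close>

lemma resolving_exchange:
  assumes res: "resolving W" and crit: "critical W u c"
    and no_edge: "\<And>y z. edge_across W c y z \<Longrightarrow> y = u \<or> z = u"
    and no_vertex: "\<And>y. y \<in> V - W \<Longrightarrow> y \<noteq> u \<Longrightarrow> N y \<inter> W \<subseteq> c \<Longrightarrow> N y \<inter> c = {}"
    and x: "x \<in> V - W" "x \<noteq> u"
    and T: "insert u c = {q, p, r}" "q \<noteq> p" "q \<noteq> r" "p \<noteq> r" "x \<in> N p" "x \<notin> N r"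
  shows "resolving (W - c \<union> {q, x})"
proof -
  obtain w w' where w: "c = {w, w'}" "w \<noteq> w'" "w \<in> W" "w' \<in> W" "w \<notin> essential W" "w' \<notin> essential W"
    "u \<in> V" "u \<notin> W" "N u \<inter> W = {w, w'}" "N w \<inter> W = {w'}" "N w' \<inter> W = {w}"
    using crit by (rule criticalE)
  let ?W = "W - c \<union> {q, x}"
  have WV: "W \<subseteq> V" using res by (simp add: resolving_def)
  have Tw: "{q, p, r} = {u, w, w'}" using T(1) w(1) by simp
  have adj: "u \<in> N w" "u \<in> N w'" "w \<in> N u" "w' \<in> N u" "w \<in> N w'" "w' \<in> N w"
    using w N_sym[of w u] N_sym[of w' u] by auto
  have TV: "{q, p, r} \<subseteq> V" unfolding Tw using w WV by auto
  have x_notin: "x \<notin> {q, p, r}" unfolding Tw using x w(3,4) by auto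
  have clique: "b \<in> N a" if "a \<in> {q, p, r}" "b \<in> {q, p, r}" "a \<noteq> b" for a b
    using that adj unfolding Tw by auto
  have iso: "N a \<inter> (W - c) = {}" if "a \<in> {q, p, r}" for a
    using that w unfolding Tw by auto
  have outside: "y \<in> {p, r} \<or> y \<in> V - W - {u, x}" if "y \<in> V - ?W" for y
  proof (cases "y \<in> {q, p, r}")
    case True
    then show ?thesis using that by auto
  next
    case False
    then show ?thesis using that w(1) unfolding Tw by auto
  qed
  \<comment> \<open>Both triangle vertices left out see \<open>q\<close>, but only \<open>p\<close>
    sees \<open>x\<close>; hence \<open>x\<close> resolves the edge between \<open>p\<close> and
    \<open>r\<close>.\<close>
  have code_p: "N p \<inter> ?W = {q, x}" and code_r: "N r \<inter> ?W = {q}"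
    using iso[of p] iso[of r] clique[of p q] clique[of r q] T(2-6) by auto
  \<comment> \<open>Such a \<open>y\<close> would see nothing of \<open>W\<close> outside
    \<open>c\<close>, yet it would see both \<open>q\<close> and \<open>b\<close>. Of these two
    triangle vertices at least one lies in \<open>c\<close>, against
    \<open>no_vertex\<close>.\<close>
  have clash: False
    if y: "y \<in> V - W - {u, x}" and b: "b \<in> {p, r}" "y \<in> N b" and eq: "N y \<inter> ?W = N b \<inter> ?W" for y b
  proof -
    have "N b \<inter> (W - c) = {}" using iso b(1) by auto
    then have "N y \<inter> W \<subseteq> c" using eq by auto
    then have "N y \<inter> c = {}" using no_vertex[of y] y by auto
    moreover have "q \<in> N b \<inter> ?W" using b(1) code_p code_r by auto
    then have "q \<in> N y" unfolding eq[symmetric] by simp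
    moreover have "b \<in> N y" using b(2) N_sym by simp
    moreover have "q \<in> c \<or> b \<in> c"
    proof -
      have "q \<in> {u, w, w'}" "b \<in> {u, w, w'}" "q \<noteq> b" unfolding Tw[symmetric] using b(1) T(2,3) by auto
      then show ?thesis using w(1) by auto
    qed
    ultimately show False by auto
  qed
  \<comment> \<open>An edge that loses its resolution was resolved by vertices of \<open>c\<close>
    only: by one of them, which would then be essential, or by exactly \<open>c\<close>, which
    \<open>no_edge\<close> excludes.\<close>
  have old: False
    if "y \<in> V - W - {u, x}" "z \<in> V - W - {u, x}" "z \<in> N y" "N y \<inter> ?W = N z \<inter> ?W" for y z
  proof -
    let ?d = "sym_diff (N y \<inter> W) (N z \<inter> W)"
    have across: "edge_across W ?d y z" using that unfolding edge_across_def by simp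
    have "N y \<inter> W \<noteq> N z \<inter> W" using res that unfolding resolving_def by auto
    then have "?d \<noteq> {}" by auto
    moreover have "?d \<in> Pow {w, w'}" using that(4) w(1) by auto
    moreover have "D = {w} \<or> D = {w'} \<or> D = c" if "D \<noteq> {}" "D \<in> Pow {w, w'}" for D
      using that w(1) by (simp add: Pow_insert) auto
    ultimately have "?d = {w} \<or> ?d = {w'} \<or> ?d = c" by metis
    then show False
    proof (elim disjE)
      assume "?d = c"
      then show False using across no_edge[of y z] that(1,2) by auto
    qed (use across w(3-6) in \<open>auto simp: essential_def\<close>)
  qed
  show ?thesis unfolding resolving_def
  proof (intro conjI ballI impI notI)
    show "?W \<subseteq> V" using WV TV x by blast
  next
    fix y z assume yz: "y \<in> V - ?W" "z \<in> V - ?W" "z \<in> N y" "N y \<inter> ?W = N z \<inter> ?W"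
    have pr: "N p \<inter> ?W \<noteq> N r \<inter> ?W" using code_p code_r x_notin by auto
    have "y \<noteq> z" using yz(3) N_irrefl by blast
    consider "y \<in> {p, r}" "z \<in> {p, r}" | "y \<in> {p, r}" "z \<in> V - W - {u, x}"
      | "y \<in> V - W - {u, x}" "z \<in> {p, r}" | "y \<in> V - W - {u, x}" "z \<in> V - W - {u, x}"
      using outside yz(1,2) by blast
    then show False
    proof cases
      case 1
      then show ?thesis using pr yz(4) \<open>y \<noteq> z\<close> by auto
    next
      case 2
      then show ?thesis using clash[of z y] yz by auto
    next
      case 3
      then show ?thesis using clash[of y z] yz N_sym by auto
    next
      case 4
      then show ?thesis using old yz by blast
    qed
  qed
qed

text \<open>The exchange destroys the isolated edge \<open>c\<close> and creates none. The new
  vertex \<open>x\<close> sees a vertex of \<open>d\<close>, which keeps its partner in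
  \<open>d\<close>, so \<open>x\<close> is in no isolated edge; \<open>q\<close> could only be
  matched with \<open>x\<close>.\<close>

lemma isolated_edges_exchange:
  assumes crit: "critical W u c" and crit': "critical W v d" "d \<noteq> c"
    and x: "x \<in> V - W" "N x \<inter> d \<noteq> {}" and q: "q \<in> insert u c"
  shows "isolated_edges (W - c \<union> {q, x}) \<subset> isolated_edges W"
proof (rule psubsetI)
  let ?W = "W - c \<union> {q, x}"
  obtain w w' where w: "c = {w, w'}" "w \<noteq> w'" "w \<in> W" "w' \<in> W" "w \<notin> essential W" "w' \<notin> essential W"
    "u \<in> V" "u \<notin> W" "N u \<inter> W = {w, w'}" "N w \<inter> W = {w'}" "N w' \<inter> W = {w}"
    using crit by (rule criticalE)
  have disj: "c \<inter> d = {}" using critical_disjoint crit crit' by blast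
  have dW: "d \<subseteq> W" using criticalD(1)[OF crit'(1)] by auto
  have q_iso: "N q \<inter> (W - c) = {}" using q w(1,9-11) by auto
  have c_iso: "b \<notin> N a" if "a \<in> W - c" "b \<in> c" for a b
  proof
    assume "b \<in> N a"
    then have "a \<in> N b \<inter> W" using N_sym that by auto
    then show False using that w(1,10,11) by auto
  qed
  obtain t t' where t: "t \<in> N x" "t \<in> d" "t' \<in> d" "t' \<in> N t" "t' \<noteq> x"
  proof -
    obtain t where t: "t \<in> N x" "t \<in> d" using x by auto
    have "card (d - {t}) = 1" using criticalD(2)[OF crit'(1)] t(2) by simp
    then obtain t' where t': "d - {t} = {t'}" by (auto simp: card_1_singleton_iff)
    moreover have "N t \<inter> W = d - {t}" using criticalD(5)[OF crit'(1) t(2)] .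
    ultimately show ?thesis using t dW x(1) by (intro that[of t t']) auto
  qed
  have tW: "t \<in> ?W" "t' \<in> ?W" using t dW disj by auto
  have old: "a \<in> W - c" if ab: "a \<in> ?W" "b \<in> ?W" "N a \<inter> ?W = {b}" "N b \<inter> ?W = {a}" for a b
  proof -
    have neq_x: "g \<noteq> x" if g: "N g \<inter> ?W = {h}" "N h \<inter> ?W = {g}" for g h
    proof
      assume "g = x"
      then have "h = t" using g(1) t tW by auto
      then have "t' \<in> {g}" using g(2) t tW by blast
      then show False using \<open>g = x\<close> t by blast
    qed
    have "a \<noteq> x" "b \<noteq> x" using neq_x[OF ab(3,4)] neq_x[OF ab(4,3)] by auto
    moreover have "a \<noteq> q"
    proof
      assume "a = q"
      then have "b \<in> N q" "b \<in> ?W" using ab by auto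
      then show False using q_iso \<open>b \<noteq> x\<close> N_irrefl by blast
    qed
    ultimately show ?thesis using ab by blast
  qed
  show "isolated_edges ?W \<subseteq> isolated_edges W"
  proof
    fix e assume "e \<in> isolated_edges ?W"
    then obtain a b where ab: "e = {a, b}" "a \<in> ?W" "b \<in> ?W" "N a \<inter> ?W = {b}" "N b \<inter> ?W = {a}"
      by (rule isolated_edgesE)
    have *: "a \<in> W - c" "b \<in> W - c" using old[OF ab(2-5)] old[OF ab(3,2,5,4)] by auto
    have "N a \<inter> W = {b}" "N b \<inter> W = {a}"
      using * ab(4,5) c_iso[of a] c_iso[of b] by auto
    then show "e \<in> isolated_edges W" using * ab(1) isolated_edgesI by auto
  qed
  have "c \<in> isolated_edges W" using w isolated_edgesI by auto
  moreover have "c \<notin> isolated_edges ?W"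
  proof
    assume "c \<in> isolated_edges ?W"
    then have "c \<subseteq> ?W" by (rule isolated_edgesE) auto
    then show False using w(1-4) x(1) by auto
  qed
  ultimately show "isolated_edges ?W \<noteq> isolated_edges W" by auto
qed

lemma card_exchange:
  assumes "critical W u c" "x \<in> V - W" "x \<noteq> u" "q \<in> insert u c" "finite W"
  shows "card (W - c \<union> {q, x}) = card W"
proof -
  obtain w w' where w: "c = {w, w'}" "w \<noteq> w'" "w \<in> W" "w' \<in> W" "u \<notin> W"
    using assms(1) by (rule criticalE)
  have "q \<noteq> x" using assms(2-4) w by auto
  then have "card {q, x} = 2" by simp
  moreover have "card (W - c \<union> {q, x}) = card (W - c) + card {q, x}"
    by (rule card_Un_disjoint) (use assms(2,4,5) w in auto)
  moreover have "card c + card (W - c) = card W"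
    using card_Diff_subset[of c W] card_mono[of W c] assms(5) w by auto
  ultimately show ?thesis using w by auto
qed

text \<open>If the vertices of \<open>c\<close> have no neighbours outside the triangle, trading one of them for
  \<open>u\<close> only increases the total degree of \<open>W\<close>.\<close>

lemma pendant_critical_not_optimal:
  assumes opt: "optimal W" and crit: "critical W u c"
    and pend: "\<And>x. x \<in> V - W \<Longrightarrow> x \<noteq> u \<Longrightarrow> N x \<inter> c = {}"
  shows False
proof -
  obtain w w' where w: "c = {w, w'}" "w \<noteq> w'" "w \<in> W" "w' \<in> W" "w \<notin> essential W" "w' \<notin> essential W"
    "u \<in> V" "u \<notin> W" "N u \<inter> W = {w, w'}" "N w \<inter> W = {w'}" "N w' \<inter> W = {w}"
    using crit by (rule criticalE)
  let ?W = "insert u (W - {w'})"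
  have res: "resolving W" and WV: "W \<subseteq> V" using opt unfolding optimal_def resolving_def by auto
  have finW: "finite W" using WV finite_V finite_subset by blast
  have nw: "N w = {w', u}"
  proof
    show "N w \<subseteq> {w', u}"
    proof
      fix x assume "x \<in> N w"
      then show "x \<in> {w', u}" using pend[of x] N_sym[of x w] N_subset[of w] w(1,10) by auto
    qed
  qed (use w N_sym[of w u] in auto)
  have nw': "N w' = {w, u}"
  proof
    show "N w' \<subseteq> {w, u}"
    proof
      fix x assume "x \<in> N w'"
      then show "x \<in> {w, u}" using pend[of x] N_sym[of x w'] N_subset[of w'] w(1,11) by auto
    qed
  qed (use w N_sym[of w' u] in auto)
  \<comment> \<open>Only \<open>w\<close> and \<open>u\<close> see \<open>w'\<close>, and both
    belong to the new set. So dropping \<open>w'\<close> cannot affect any edge between the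
    remaining vertices.\<close>
  have far: "w' \<notin> N y" if "y \<notin> {w, u}" for y using that nw' N_sym[of w' y] by auto
  have res': "resolving ?W" unfolding resolving_def
  proof (intro conjI ballI impI notI)
    show "?W \<subseteq> V" using WV w by blast
  next
    fix y z assume yz: "y \<in> V - ?W" "z \<in> V - ?W" "z \<in> N y" "N y \<inter> ?W = N z \<inter> ?W"
    have "y \<noteq> w'" using yz nw' w by auto
    moreover have "z \<noteq> w'" using yz(1,3) nw' w N_sym[of z y] by auto
    moreover have "w' \<notin> N y" "w' \<notin> N z" using far yz w by auto
    ultimately have "y \<in> V - W" "z \<in> V - W" "N y \<inter> W = N z \<inter> W" using yz by auto
    then show False using res yz(3) unfolding resolving_def by blast
  qed
  have card_eq: "card ?W = card W"
    using card_insert_disjoint[of "W - {w'}" u] card_Suc_Diff1[OF finW w(4)] finW w(8) by simp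
  \<comment> \<open>The edge \<open>c\<close> is lost and at most the edge from \<open>w\<close> to
    \<open>u\<close> is gained, so the second entry of the measure does not grow.\<close>
  have "isolated_edges ?W \<subseteq> insert {w, u} (isolated_edges W - {c})"
  proof
    fix e assume "e \<in> isolated_edges ?W"
    then obtain a b where ab: "e = {a, b}" "a \<in> ?W" "b \<in> ?W" "N a \<inter> ?W = {b}" "N b \<inter> ?W = {a}"
      by (rule isolated_edgesE)
    have u_code: "N u \<inter> ?W = {w}" using w N_irrefl[of u] by auto
    have w_code: "N w \<inter> ?W = {u}" using nw w by auto
    show "e \<in> insert {w, u} (isolated_edges W - {c})"
    proof (cases "a \<in> {w, u} \<or> b \<in> {w, u}")
      case True
      then have "e = {w, u}" using ab u_code w_code by auto
      then show ?thesis by blast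
    next
      case False
      then have *: "a \<in> W" "b \<in> W" "w' \<notin> N a" "w' \<notin> N b" using ab far by auto
      have "u \<notin> N a" "u \<notin> N b" using ab False by auto
      then have "N a \<inter> W = {b}" "N b \<inter> W = {a}" using ab(4,5) * by auto
      then have "e \<in> isolated_edges W" using * ab(1) isolated_edgesI by auto
      moreover have "w \<in> c" "w \<notin> e" using False ab(1) w(1) by auto
      ultimately show ?thesis by blast
    qed
  qed
  then have "card (isolated_edges ?W) \<le> card (insert {w, u} (isolated_edges W - {c}))"
    using finite_isolated_edges[OF WV] by (intro card_mono) auto
  also have "\<dots> \<le> Suc (card (isolated_edges W - {c}))" by (rule card_insert_le_m1) auto
  also have "\<dots> = card (isolated_edges W)"
  proof (rule card_Suc_Diff1)
    show "c \<in> isolated_edges W" using w isolated_edgesI by auto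
  qed (rule finite_isolated_edges[OF WV])
  finally have iso_le: "card (isolated_edges ?W) \<le> card (isolated_edges W)" .
  \<comment> \<open>As there are at least four vertices, an edge leaves the triangle. It starts at
    \<open>u\<close>, because \<open>w\<close> and \<open>w'\<close> have no neighbours elsewhere;
    hence \<open>u\<close> has degree at least 3, but \<open>w'\<close> only 2.\<close>
  have TV: "{w, w', u} \<subseteq> V" using w WV by auto
  moreover have "{w, w', u} \<noteq> V"
  proof
    assume "{w, w', u} = V"
    moreover have "card {w, w', u} \<le> 3" by (simp add: card_insert_if)
    ultimately show False using card_V by simp
  qed
  ultimately obtain a x where ax: "a \<in> {w, w', u}" "x \<in> V - {w, w', u}" "x \<in> N a"
    using edge_leaving[of "{w, w', u}"] by blast
  then have "{w, w', x} \<subseteq> N u" using nw nw' w(9) by auto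
  moreover have "card {w, w', x} = 3" using ax w(2) by auto
  ultimately have deg: "3 \<le> card (N u)"
    using card_mono[of "N u" "{w, w', x}"] finite_subset[OF N_subset finite_V] by metis
  have "V - ?W = insert w' (V - W - {u})" using w WV by auto
  then have "(\<Sum>v\<in>V - ?W. card (N v)) = card (N w') + (\<Sum>v\<in>V - W - {u}. card (N v))"
    using finite_V w by simp
  also have "\<dots> < card (N u) + (\<Sum>v\<in>V - W - {u}. card (N v))"
  proof -
    have "card (N w') \<le> 2" unfolding nw' by (simp add: card_insert_if)
    then show ?thesis using deg by simp
  qed
  also have "\<dots> = (\<Sum>v\<in>V - W. card (N v))"
    using sum.remove[of "V - W" u "\<lambda>v. card (N v)"] finite_V w by simp
  finally have "(\<Sum>v\<in>V - ?W. card (N v)) < (\<Sum>v\<in>V - W. card (N v))" .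
  then have "(?W, W) \<in> measures [card, \<lambda>W. card (isolated_edges W), \<lambda>W. \<Sum>v\<in>V - W. card (N v)]"
    using card_eq iso_le by auto
  then show False using opt res' unfolding optimal_def by blast
qed

text \<open>If both alternatives fail, every outside vertex other than \<open>u\<close> that sees
  \<open>c\<close> also sees another critical pair. Such an \<open>x\<close> exists by
  \<open>pendant_critical_not_optimal\<close>, and exchanging at it gives a resolving set of equal
  size with fewer isolated edges.\<close>

lemma critical_witness:
  assumes opt: "optimal W" and crit: "critical W u c"
  shows "(\<exists>y z. edge_across W c y z \<and> y \<noteq> u \<and> z \<noteq> u) \<or>
    (\<exists>x\<in>V - W. x \<noteq> u \<and> N x \<inter> c \<noteq> {} \<and> (\<forall>v d. critical W v d \<longrightarrow> d \<noteq> c \<longrightarrow> N x \<inter> d = {}))"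
proof (rule ccontr)
  assume neg: "\<not> ?thesis"
  have no_edge: "\<And>y z. edge_across W c y z \<Longrightarrow> y = u \<or> z = u" using neg by blast
  have other: "\<exists>v d. critical W v d \<and> d \<noteq> c \<and> N x \<inter> d \<noteq> {}"
    if "x \<in> V - W" "x \<noteq> u" "N x \<inter> c \<noteq> {}" for x using neg that by blast
  have res: "resolving W" and WV: "W \<subseteq> V" using opt unfolding optimal_def resolving_def by auto
  have finW: "finite W" using WV finite_V finite_subset by blast
  obtain x where x: "x \<in> V - W" "x \<noteq> u" "N x \<inter> c \<noteq> {}"
    using pendant_critical_not_optimal[OF opt crit] by blast
  obtain v d where vd: "critical W v d" "d \<noteq> c" "N x \<inter> d \<noteq> {}" using other[OF x] by auto
  obtain w w' where w: "c = {w, w'}" "w \<noteq> w'" "w \<in> W" "w' \<in> W" "w \<notin> essential W" "w' \<notin> essential W"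
    "u \<in> V" "u \<notin> W" "N u \<inter> W = {w, w'}" "N w \<inter> W = {w'}" "N w' \<inter> W = {w}"
    using crit by (rule criticalE)
  have no_vertex: "N y \<inter> c = {}" if y: "y \<in> V - W" "y \<noteq> u" "N y \<inter> W \<subseteq> c" for y
  proof (rule ccontr)
    assume "N y \<inter> c \<noteq> {}"
    then obtain v d where "critical W v d" "d \<noteq> c" "N y \<inter> d \<noteq> {}" using other[OF y(1,2)] by auto
    moreover from this have "d \<inter> c = {}" "d \<subseteq> W"
      using critical_disjoint[OF _ crit] criticalD(1)[of W v d] by auto
    ultimately show False using y(3) by auto
  qed
  have not_all: "\<not> (w \<in> N x \<and> w' \<in> N x \<and> u \<in> N x)"
    using no_K4[of w x w' u] w(9,10) N_sym[of w u] N_sym[of w' u] by auto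
  \<comment> \<open>Since \<open>x\<close> sees a vertex of \<open>c\<close> but not the whole
    triangle, one seen vertex can serve as \<open>p\<close> and one unseen vertex as
    \<open>r\<close>; the third, \<open>q\<close>, is kept.\<close>
  obtain q p r where T: "insert u c = {q, p, r}" "q \<noteq> p" "q \<noteq> r" "p \<noteq> r" "p \<in> N x" "r \<notin> N x"
  proof -
    have ne: "u \<noteq> w" "u \<noteq> w'" using w by auto
    consider "w \<in> N x" "w' \<notin> N x" | "w' \<in> N x" "w \<notin> N x" | "w \<in> N x" "w' \<in> N x" "u \<notin> N x"
      using x(3) not_all w(1) by auto
    then show ?thesis
    proof cases
      case 1
      then show ?thesis using that[of u w w'] w ne by auto
    next
      case 2
      then show ?thesis using that[of u w' w] w ne by auto
    next
      case 3
      then show ?thesis using that[of w' w u] w ne by auto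
    qed
  qed
  have q: "q \<in> insert u c" using T by blast
  let ?W = "W - c \<union> {q, x}"
  have res': "resolving ?W"
    by (rule resolving_exchange[OF res crit no_edge no_vertex x(1,2) T(1-4)]) (use T N_sym in blast)+
  have "card (isolated_edges ?W) < card (isolated_edges W)"
    using isolated_edges_exchange[OF crit vd(1,2) x(1) vd(3) q] finite_isolated_edges[OF WV]
    by (rule psubset_card_mono[rotated])
  then have "(?W, W) \<in> measures [card, \<lambda>W. card (isolated_edges W), \<lambda>W. \<Sum>v\<in>V - W. card (N v)]"
    using card_exchange[OF crit x(1,2) q finW] by auto
  then show False using opt res' unfolding optimal_def by blast
qed

section \<open>The forest count\<close>

text \<open>Every vertex of \<open>W\<close> is charged to one object outside \<open>W\<close>: an
  essential vertex to a selected edge, a vertex \<open>w\<close> of \<open>S\<close> to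
  \<open>f w\<close>, and the two members of a critical pair \<open>c\<close> to \<open>h c\<close>
  and to either a selected edge (\<open>c\<close> in \<open>K\<close>) or the vertex
  \<open>k c\<close>. Then \<open>forest_card_le\<close> bounds the number of objects by
  \<open>card (V - W)\<close>.\<close>

theorem ex_small_resolving: "\<exists>W. resolving W \<and> 2 * card W \<le> card V"
proof -
  obtain W where opt: "optimal W" using ex_optimal by auto
  have res: "resolving W" and WV: "W \<subseteq> V" using opt unfolding optimal_def resolving_def by auto
  have finW: "finite W" using WV finite_V finite_subset by auto
  define P where "P = {c. \<exists>u. critical W u c}"
  define S where "S = W - essential W - \<Union>P"
  obtain h where "\<forall>c\<in>P. critical W (h c) c"
    using bchoice[of P "\<lambda>c u. critical W u c"] unfolding P_def by auto
  then have h: "critical W (h c) c" if "c \<in> P" for c using that by auto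
  have P_disj: "c \<inter> d = {}" if "c \<in> P" "d \<in> P" "c \<noteq> d" for c d
    using critical_disjoint h that by metis
  have P_sub: "c \<subseteq> W - essential W" "card c = 2" if "c \<in> P" for c
    using criticalD(1,2)[OF h[OF that]] .
  have "\<forall>w\<in>S. \<exists>u. u \<in> V - W \<and> N u \<inter> W = insert w (N w \<inter> W)"
    using nonessential_neighbour[OF opt] unfolding S_def by (metis DiffD1 DiffD2)
  then obtain f where "\<forall>w\<in>S. f w \<in> V - W \<and> N (f w) \<inter> W = insert w (N w \<inter> W)"
    by (rule bchoice[THEN exE])
  then have f: "f w \<in> V - W" "N (f w) \<inter> W = insert w (N w \<inter> W)" if "w \<in> S" for w
    using that by auto
  define K where "K = {c \<in> P. \<exists>y z. edge_across W c y z \<and> y \<noteq> h c \<and> z \<noteq> h c}"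
  have "\<forall>c\<in>P - K. \<exists>x. x \<in> V - W \<and> x \<noteq> h c \<and> N x \<inter> c \<noteq> {} \<and>
    (\<forall>d\<in>P. d \<noteq> c \<longrightarrow> N x \<inter> d = {})"
  proof
    fix c assume c: "c \<in> P - K"
    have "\<not> (\<exists>y z. edge_across W c y z \<and> y \<noteq> h c \<and> z \<noteq> h c)" using c unfolding K_def by simp
    then obtain x where x: "x \<in> V - W" "x \<noteq> h c" "N x \<inter> c \<noteq> {}"
      "\<forall>v d. critical W v d \<longrightarrow> d \<noteq> c \<longrightarrow> N x \<inter> d = {}"
      using critical_witness[OF opt h[of c]] c by auto
    have "\<forall>d\<in>P. d \<noteq> c \<longrightarrow> N x \<inter> d = {}" using x(4) h by auto
    with x(1-3) show "\<exists>x. x \<in> V - W \<and> x \<noteq> h c \<and> N x \<inter> c \<noteq> {} \<and>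
      (\<forall>d\<in>P. d \<noteq> c \<longrightarrow> N x \<inter> d = {})" by (intro exI[of _ x]) simp
  qed
  then obtain k where "\<forall>c\<in>P - K. k c \<in> V - W \<and> k c \<noteq> h c \<and> N (k c) \<inter> c \<noteq> {} \<and>
    (\<forall>d\<in>P. d \<noteq> c \<longrightarrow> N (k c) \<inter> d = {})"
    by (rule bchoice[THEN exE])
  then have k: "k c \<in> V - W" "k c \<noteq> h c" "N (k c) \<inter> c \<noteq> {}"
    "d \<in> P \<Longrightarrow> d \<noteq> c \<Longrightarrow> N (k c) \<inter> d = {}" if "c \<in> P - K" for c d
    using that by simp_all
  \<comment> \<open>Each selected edge is indexed by the set of vertices resolving it; these sets
    are pairwise disjoint.\<close>
  define D where "D = (\<lambda>w. {w}) ` essential W \<union> K"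
  have KP: "K \<subseteq> P" unfolding K_def by auto
  have D_edge: "\<exists>y z. edge_across W d y z \<and> (d \<in> P \<longrightarrow> y \<noteq> h d \<and> z \<noteq> h d)" if "d \<in> D" for d
    using that unfolding D_def
  proof
    assume "d \<in> (\<lambda>w. {w}) ` essential W"
    then obtain w where w: "d = {w}" "w \<in> essential W" by auto
    then have "d \<notin> P" using P_sub(2)[of d] by auto
    then show ?thesis using w unfolding essential_def by auto
  qed (auto simp: K_def)
  have "\<forall>d\<in>D. \<exists>e. edge_across W d (fst e) (snd e) \<and> (d \<in> P \<longrightarrow> fst e \<noteq> h d \<and> snd e \<noteq> h d)"
    using D_edge by simp
  then obtain E where
    E: "\<forall>d\<in>D. edge_across W d (fst (E d)) (snd (E d)) \<and> (d \<in> P \<longrightarrow> fst (E d) \<noteq> h d \<and> snd (E d) \<noteq> h d)"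
    by (rule bchoice[THEN exE])
  define Y Z where "Y = fst \<circ> E" and "Z = snd \<circ> E"
  from E have "\<forall>d\<in>D. edge_across W d (Y d) (Z d) \<and> (d \<in> P \<longrightarrow> Y d \<noteq> h d \<and> Z d \<noteq> h d)"
    by (simp add: Y_def Z_def)
  then have YZ: "edge_across W d (Y d) (Z d)"
    "d \<in> P \<Longrightarrow> Y d \<noteq> h d" "d \<in> P \<Longrightarrow> Z d \<noteq> h d" if "d \<in> D" for d
    using that by simp_all
  have D_disj: "c \<inter> d = {}" if "c \<in> P" "d \<in> D" "d \<noteq> c" for c d
    using that(2) unfolding D_def
  proof
    assume "d \<in> (\<lambda>w. {w}) ` essential W"
    then show ?thesis using P_sub(1)[OF that(1)] by auto
  next
    assume "d \<in> K"
    then show ?thesis using P_disj that KP by auto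
  qed
  have D_mem: "w \<in> essential W \<union> \<Union>P" if "d \<in> D" "w \<in> d" for d w
    using that KP unfolding D_def by auto
  let ?C = "(links Y Z D)\<^sup>*"
  have link: "\<exists>d\<in>D. edge_across W d a b \<and> (d \<in> P \<longrightarrow> a \<noteq> h d)" if "(a, b) \<in> links Y Z D" for a b
  proof -
    from that obtain d where d: "d \<in> D" "(a, b) = (Y d, Z d) \<or> (a, b) = (Z d, Y d)"
      unfolding links_def by auto
    moreover have "edge_across W d (Z d) (Y d)"
      using YZ(1)[OF d(1)] N_sym unfolding edge_across_def by (simp add: Un_commute)
    ultimately show ?thesis using YZ[OF d(1)] by auto
  qed
  have const: "N a \<inter> c = N b \<inter> c" if "(a, b) \<in> ?C" "c \<subseteq> W" "\<And>d. d \<in> D \<Longrightarrow> c \<inter> d = {}" for a b c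
    using that(1)
  proof (rule links_rtrancl_invariant[where f = "\<lambda>v. N v \<inter> c"])
    fix d assume "d \<in> D"
    then show "N (Y d) \<inter> c = N (Z d) \<inter> c"
      using edge_across_inter_eq[OF YZ(1)] that by auto
  qed
  \<comment> \<open>\<open>h c\<close> is isolated in the forest. The edge selected for
    \<open>c\<close> avoids it, and along any other selected edge the sight of \<open>c\<close> is
    preserved, so both ends together with \<open>c\<close> would form a forbidden clique.\<close>
  have hh: "b = h c" if "c \<in> P" "(h c, b) \<in> ?C" for c b
  proof (rule ccontr)
    assume "b \<noteq> h c"
    with that(2) obtain z where "(h c, z) \<in> links Y Z D" by (metis converse_rtranclE)
    then obtain d where d: "d \<in> D" "edge_across W d (h c) z" "d \<in> P \<longrightarrow> h c \<noteq> h d"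
      using link by auto
    note crit = h[OF that(1)]
    obtain w w' where w: "c = {w, w'}" "w \<noteq> w'" "w \<in> W" "w' \<in> W"
      "N (h c) \<inter> W = {w, w'}" "N w \<inter> W = {w'}"
      using crit by (rule criticalE)
    have "d \<noteq> c" using d(3) that(1) by auto
    then have "N (h c) \<inter> c = N z \<inter> c"
      using edge_across_inter_eq[OF d(2)] D_disj[OF that(1) d(1)] w(1,3,4) by simp
    moreover have "z \<in> N (h c)" using d(2) unfolding edge_across_def by simp
    moreover have "w \<in> N (h c)" "w' \<in> N (h c)" "w' \<in> N w" using w(5,6) by auto
    ultimately show False using no_K4[of z "h c" w w'] w(1) by auto
  qed
  have h_inj: "c = c'" if "c \<in> P" "c' \<in> P" "h c = h c'" for c c'
    using criticalD(4)[OF h[OF that(1)]] criticalD(4)[OF h[OF that(2)]] that(3) by metis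
  have f_h: "f w \<noteq> h c" if "w \<in> S" "c \<in> P" for w c
  proof
    assume "f w = h c"
    then have "c = insert w (N w \<inter> W)" using criticalD(4)[OF h[OF that(2)]] f(2)[OF that(1)] by simp
    then have "w \<in> \<Union>P" using that(2) by auto
    then show False using that(1) unfolding S_def by simp
  qed
  have k_h: "k c' \<noteq> h c" if "c' \<in> P - K" "c \<in> P" for c c'
  proof (cases "c = c'")
    case True
    then show ?thesis using k(2)[OF that(1)] by simp
  next
    case False
    then have "N (k c') \<inter> c = {}" using k(4)[OF that] by simp
    moreover have "N (h c) \<inter> W = c" "c \<noteq> {}" using criticalD(2,4)[OF h[OF that(2)]] by auto
    then have "N (h c) \<inter> c \<noteq> {}" by blast
    ultimately show ?thesis by metis
  qed
  \<comment> \<open>No selected edge is resolved by \<open>w1\<close> or \<open>w2\<close>, so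
    \<open>f w1\<close> sees both, and these are adjacent. Equal images would make them a critical
    pair; otherwise the first edge of the connecting path gives a forbidden clique.\<close>
  have ff: "w1 = w2" if w: "w1 \<in> S" "w2 \<in> S" "(f w1, f w2) \<in> ?C" for w1 w2
  proof (rule ccontr)
    assume ne: "w1 \<noteq> w2"
    have disj: "{w1, w2} \<inter> d = {}" if "d \<in> D" for d
      using D_mem[OF that] w(1,2) unfolding S_def by auto
    have sub: "{w1, w2} \<subseteq> W" using w(1,2) unfolding S_def by auto
    have m1: "w1 \<in> N (f w1) \<inter> W" unfolding f(2)[OF w(1)] by simp
    have m2: "w2 \<in> N (f w2) \<inter> W" unfolding f(2)[OF w(2)] by simp
    have "N (f w1) \<inter> {w1, w2} = N (f w2) \<inter> {w1, w2}" by (rule const[OF w(3) sub disj])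
    then have m3: "w2 \<in> N (f w1) \<inter> W" using m2 by auto
    have adj: "w2 \<in> N w1" using m3 ne unfolding f(2)[OF w(1)] by simp
    show False
    proof (cases "f w1 = f w2")
      case True
      then have "critical W (f w1) {w1, w2}"
        using nonessential_twins_critical[of w1 W w2 "f w1"] f[OF w(1)] f[OF w(2)] ne w(1,2)
        unfolding S_def by simp
      then have "w1 \<in> \<Union>P" unfolding P_def by auto
      then show False using w(1) unfolding S_def by simp
    next
      case False
      with w(3) obtain z where "(f w1, z) \<in> links Y Z D" by (metis converse_rtranclE)
      then obtain d where d: "d \<in> D" "edge_across W d (f w1) z" using link by auto
      have "N (f w1) \<inter> {w1, w2} = N z \<inter> {w1, w2}"
        by (rule edge_across_inter_eq[OF d(2) sub disj[OF d(1)]])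
      moreover have "z \<in> N (f w1)" using d(2) unfolding edge_across_def by simp
      ultimately show False using no_K4[of z "f w1" w1 w2] m1 m3 adj by auto
    qed
  qed
  \<comment> \<open>A pair outside \<open>K\<close> is disjoint from every index in
    \<open>D\<close>, so what is seen of it is constant on components.\<close>
  have P_const: "N a \<inter> c = N b \<inter> c" if "(a, b) \<in> ?C" "c \<in> P - K" for a b c
  proof (rule const[OF that(1)])
    show "c \<subseteq> W" using P_sub(1)[of c] that(2) by auto
    fix d assume d: "d \<in> D"
    have "c \<notin> (\<lambda>w. {w}) ` essential W" using P_sub(2)[of c] that(2) by auto
    then have "d \<noteq> c" using d that(2) unfolding D_def by auto
    then show "c \<inter> d = {}" using D_disj d that(2) by auto
  qed
  \<comment> \<open>Otherwise \<open>f w\<close> would see some \<open>t\<close> in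
    \<open>c\<close>. Then \<open>t\<close> is adjacent to \<open>w\<close>, although its only
    neighbour in \<open>W\<close> is its partner in \<open>c\<close>.\<close>
  have fk: "(f w, k c) \<notin> ?C" if "w \<in> S" "c \<in> P - K" for w c
  proof
    assume "(f w, k c) \<in> ?C"
    then have "N (f w) \<inter> c \<noteq> {}" using P_const[OF _ that(2)] k(3)[OF that(2)] by metis
    then obtain t where t: "t \<in> N (f w)" "t \<in> c" by auto
    have c: "c \<in> P" "c \<subseteq> W" using that(2) P_sub(1)[of c] by auto
    have w: "w \<in> W" "w \<notin> c" using that(1) c(1) unfolding S_def by auto
    have "t \<in> N (f w) \<inter> W" using t c by auto
    then have "t \<in> N w" unfolding f(2)[OF that(1)] using t(2) w(2) by auto
    then have "w \<in> N t \<inter> W" using N_sym w(1) by simp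
    then show False using criticalD(5)[OF h[OF c(1)] t(2)] w(2) by simp
  qed
  \<comment> \<open>\<open>k c'\<close> sees the pair \<open>c'\<close>, whereas \<open>k c\<close>
    sees no critical pair other than \<open>c\<close>.\<close>
  have kk: "c = c'" if "c \<in> P - K" "c' \<in> P - K" "(k c, k c') \<in> ?C" for c c'
  proof (rule ccontr)
    assume "c \<noteq> c'"
    then have "N (k c) \<inter> c' = {}" using k(4)[OF that(1), of c'] that(2) by simp
    then show False using P_const[OF that(3,2)] k(3)[OF that(2)] by simp
  qed
  have finE: "finite (essential W)" using finW unfolding essential_def by simp
  have finP: "finite P"
    by (rule finite_subset[of _ "Pow W"]) (use P_sub(1) finW in auto)
  have finS: "finite S" using finW unfolding S_def by simp
  have finK: "finite K" using KP finP finite_subset by auto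
  let ?R = "f ` S \<union> h ` P \<union> k ` (P - K)"
  have sep: "a = b" if "a \<in> ?R" "b \<in> ?R" "(a, b) \<in> ?C" for a b
  proof -
    note ab = that(1,2)
    have cab: "(b, a) \<in> ?C" using that(3) by (rule links_rtrancl_sym)
    consider "a \<in> h ` P" | "b \<in> h ` P" | "a \<in> f ` S" "b \<in> f ` S" | "a \<in> f ` S" "b \<in> k ` (P - K)"
      | "a \<in> k ` (P - K)" "b \<in> f ` S" | "a \<in> k ` (P - K)" "b \<in> k ` (P - K)"
      using ab by blast
    then show ?thesis
    proof cases
      case 1
      then show ?thesis using hh that(3) by auto
    next
      case 2
      then show ?thesis using hh cab by auto
    next
      case 3
      then show ?thesis using ff that(3) by auto
    next
      case 4
      then show ?thesis using fk that(3) by auto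
    next
      case 5
      then show ?thesis using fk cab by auto
    next
      case 6
      then show ?thesis using kk that(3) by auto
    qed
  qed
  have "card D + card ?R \<le> card (V - W)"
  proof (rule forest_card_le[where Y = Y and Z = Z and \<phi> = "\<lambda>d v. N v \<inter> d"])
    show "finite D" unfolding D_def using finE finK by simp
    show "finite (V - W)" using finite_V by simp
    show "Y ` D \<subseteq> V - W" "Z ` D \<subseteq> V - W" using YZ(1) unfolding edge_across_def by auto
    have "h c \<in> V - W" if "c \<in> P" for c using criticalD(3)[OF h[OF that]] .
    then show "?R \<subseteq> V - W" using f(1) k(1) by auto
  next
    fix d assume d: "d \<in> D"
    have "d \<noteq> {}" using d P_sub(2)[of d] KP unfolding D_def by auto
    then show "N (Y d) \<inter> d \<noteq> N (Z d) \<inter> d" using edge_across_inter_neq[OF YZ(1)[OF d]] by simp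
  next
    fix d e assume de: "d \<in> D" "e \<in> D" "d \<noteq> e"
    have "d \<subseteq> W" using de(1) KP P_sub(1)[of d] unfolding D_def essential_def by auto
    moreover have "d \<inter> e = {}"
    proof (cases "d \<in> P \<or> e \<in> P")
      case True
      then show ?thesis using D_disj[of d e] D_disj[of e d] de by auto
    next
      case False
      then show ?thesis using de KP unfolding D_def by auto
    qed
    ultimately show "N (Y e) \<inter> d = N (Z e) \<inter> d"
      using edge_across_inter_eq[OF YZ(1)[OF de(2)]] by simp
  qed (rule sep)
  moreover have "card D = card (essential W) + card K"
  proof -
    have "card D = card ((\<lambda>w. {w}) ` essential W) + card K"
      unfolding D_def
    proof (rule card_Un_disjoint)
      show "(\<lambda>w. {w}) ` essential W \<inter> K = {}" using KP P_sub(2) by fastforce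
    qed (use finE finK in auto)
    then show ?thesis by (simp add: card_image)
  qed
  moreover have "card ?R = card S + card P + card (P - K)"
  proof -
    have "inj_on f S" using ff by (auto intro: inj_onI)
    moreover have "inj_on h P" using h_inj by (auto intro: inj_onI)
    moreover have "inj_on k (P - K)" using kk by (intro inj_onI) auto
    moreover have "f ` S \<inter> h ` P = {}" using f_h by auto
    moreover have "(f ` S \<union> h ` P) \<inter> k ` (P - K) = {}"
    proof -
      have "k c \<noteq> f w" if "w \<in> S" "c \<in> P - K" for w c using fk[OF that] by auto
      then show ?thesis using k_h by auto
    qed
    ultimately show ?thesis using finS finP by (simp add: card_Un_disjoint card_image)
  qed
  moreover have "card (P - K) + card K = card P"
    using card_Diff_subset[OF finK KP] card_mono[OF finP KP] by simp
  moreover have "card W = card (essential W) + card S + 2 * card P"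
  proof -
    have sub: "\<Union>P \<subseteq> W - essential W" using P_sub(1) by auto
    have fin: "finite (\<Union>P)" using sub finW by (meson finite_Diff finite_subset)
    have "2 * card P = card (\<Union>P)"
      by (rule card_partition) (use finP fin P_sub(2) P_disj in auto)
    moreover have "card S = card (W - essential W) - card (\<Union>P)"
      unfolding S_def by (rule card_Diff_subset[OF fin sub])
    moreover have "card (\<Union>P) \<le> card (W - essential W)" using sub finW by (simp add: card_mono)
    moreover have "card (W - essential W) = card W - card (essential W)"
      by (rule card_Diff_subset[OF finE]) (auto simp: essential_def)
    moreover have "card (essential W) \<le> card W"
      by (rule card_mono[OF finW]) (auto simp: essential_def)
    ultimately show ?thesis by simp
  qed
  moreover have "card (V - W) = card V - card W" by (rule card_Diff_subset[OF finW WV])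
  moreover have "card W \<le> card V" by (rule card_mono[OF finite_V WV])
  ultimately have "2 * card W \<le> card V" by simp
  then show ?thesis using res by auto
qed

end

section \<open>Neighbourhoods, cliques and distances in a graph\<close>

context graph
begin

definition neighbours :: "'a \<Rightarrow> 'a set" where
  "neighbours v = {u. v \<rightarrow> u}"

lemma neighbours_sym: "u \<in> neighbours v \<Longrightarrow> v \<in> neighbours u"
  using sym_arcs by (auto simp: neighbours_def symmetric_def sym_def)

lemma neighbours_irrefl: "v \<notin> neighbours v"
  using no_loops by (auto simp: neighbours_def arcs_ends_conv)

lemma neighbours_subset: "neighbours v \<subseteq> verts G"
  by (auto simp: neighbours_def dest: adj_in_verts)

text \<open>A set that no edge leaves contains everything reachable from it.\<close>

lemma edge_leaving_if_connected:
  assumes "connected G" "T \<subseteq> verts G" "T \<noteq> {}" "T \<noteq> verts G"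
  shows "\<exists>a\<in>T. \<exists>x\<in>verts G - T. x \<in> neighbours a"
proof (rule ccontr)
  assume closed: "\<not> ?thesis"
  obtain s t where st: "s \<in> T" "t \<in> verts G" "t \<notin> T" using assms by blast
  have "strongly_connected G" using sym_arcs assms(1) by (rule symmetric_connected_imp_strongly_connected)
  then have "s \<rightarrow>\<^sup>* t" using st assms(2) by (auto simp: strongly_connected_def)
  then have "t \<in> T"
  proof (induction rule: reachable_induct)
    case (step v w)
    then show ?case using closed adj_in_verts(2) by (auto simp: neighbours_def)
  qed (rule st(1))
  then show False using st(3) by simp
qed

lemma complete_digraph_induce_subgraph:
  assumes "C \<subseteq> verts G" "\<And>u v. u \<in> C \<Longrightarrow> v \<in> C \<Longrightarrow> u \<noteq> v \<Longrightarrow> u \<rightarrow> v"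
  shows "complete_digraph (card C) (G \<restriction> C)"
proof -
  have ends: "arcs_ends (G \<restriction> C) = {(u, v) \<in> arcs_ends G. u \<in> C \<and> v \<in> C}"
    by (auto simp: arcs_ends_conv)
  have "digraph (G \<restriction> C)"
    by (rule digraph_subgraph[OF induced_imp_subgraph[OF induced_induce[OF assms(1)]]])
  moreover have "symmetric (G \<restriction> C)"
    using sym_arcs unfolding symmetric_def ends by (auto simp: sym_def)
  ultimately have "graph (G \<restriction> C)" by (rule digraph.graphI)
  moreover have "arcs_ends (G \<restriction> C) = {(u, v). (u, v) \<in> C \<times> C \<and> u \<noteq> v}"
    unfolding ends using assms(2) adj_not_same by auto
  ultimately show ?thesis by (simp add: complete_digraph_def)
qed

lemma card_clique_le_clique_number:
  assumes "C \<subseteq> verts G" "\<And>u v. u \<in> C \<Longrightarrow> v \<in> C \<Longrightarrow> u \<noteq> v \<Longrightarrow> u \<rightarrow> v"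
  shows "card C \<le> clique_number G"
  unfolding clique_number_def
proof (rule Max_ge)
  show "finite {k. \<exists>H. subgraph H G \<and> complete_digraph k H}"
    by (rule finite_subset[of _ "{..card (verts G)}"])
      (auto simp: complete_digraph_def subgraph_def intro!: card_mono)
  have "subgraph (G \<restriction> C) G" using induced_induce[OF assms(1)] by (rule induced_imp_subgraph)
  then show "card C \<in> {k. \<exists>H. subgraph H G \<and> complete_digraph k H}"
    using complete_digraph_induce_subgraph[OF assms] by blast
qed

text \<open>Reachability guarantees that the \<open>LEAST\<close> in \<open>graph_dist\<close> is
  attained by an actual path.\<close>

lemma graph_dist_eq_1_iff:
  assumes "u \<rightarrow>\<^sup>* v" "u \<noteq> v"
  shows "graph_dist G u v = 1 \<longleftrightarrow> u \<rightarrow> v"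
proof -
  have ex: "\<exists>p. apath u p v \<and> length p = graph_dist G u v"
  proof -
    obtain p where "apath u p v" using assms(1) reachable_apath by auto
    then have "\<exists>k p. apath u p v \<and> length p = k" by auto
    then show ?thesis unfolding graph_dist_def by (rule LeastI_ex)
  qed
  show ?thesis
  proof
    assume "graph_dist G u v = 1"
    then obtain e where "apath u [e] v" using ex by (auto simp: length_Suc_conv)
    then show "u \<rightarrow> v" by (auto simp: apath_def awalk_simps arcs_ends_conv)
  next
    assume "u \<rightarrow> v"
    then obtain e where "e \<in> arcs G" "tail G e = u" "head G e = v" by auto
    then have "apath u [e] v" using assms(2) by (auto simp: apath_simps)
    then have "graph_dist G u v \<le> 1"
      unfolding graph_dist_def by (intro Least_le) auto
    moreover have "graph_dist G u v \<noteq> 0" using ex assms(2) by (metis apath_Nil_iff length_0_conv)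
    ultimately show "graph_dist G u v = 1" by simp
  qed
qed

text \<open>A vertex adjacent to exactly one of \<open>y\<close> and \<open>z\<close> is at distance
  1 from exactly one of them, hence distinguishes them.\<close>

lemma local_resolving_setI:
  assumes "connected G" "W \<subseteq> verts G"
    and "\<And>y z. \<lbrakk>y \<in> verts G - W; z \<in> verts G - W; z \<in> neighbours y\<rbrakk>
      \<Longrightarrow> neighbours y \<inter> W \<noteq> neighbours z \<inter> W"
  shows "local_resolving_set G W"
  unfolding local_resolving_set_def
proof (intro conjI ballI impI assms(2))
  fix y z assume yz: "y \<in> verts G - W" "z \<in> verts G - W" "y \<rightarrow> z"
  have "neighbours y \<inter> W \<noteq> neighbours z \<inter> W"
    using assms(3) yz by (simp add: neighbours_def)
  then obtain w where w: "w \<in> W" "w \<in> neighbours y \<longleftrightarrow> w \<notin> neighbours z" by blast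
  have "strongly_connected G" using sym_arcs assms(1) by (rule symmetric_connected_imp_strongly_connected)
  then have "y \<rightarrow>\<^sup>* w" "z \<rightarrow>\<^sup>* w" using yz w(1) assms(2) by (auto simp: strongly_connected_def)
  moreover have "y \<noteq> w" "z \<noteq> w" using yz w(1) by auto
  ultimately have "graph_dist G y w = 1 \<longleftrightarrow> graph_dist G z w \<noteq> 1"
    using w(2) graph_dist_eq_1_iff[of y w] graph_dist_eq_1_iff[of z w] by (simp add: neighbours_def)
  then show "\<exists>w\<in>W. distinguishes G w y z"
    using w(1) unfolding distinguishes_def by metis
qed

lemma local_metric_dimension_le:
  assumes "local_resolving_set G W"
  shows "local_metric_dimension G \<le> card W"
  unfolding local_metric_dimension_def
proof (rule Min_le)
  have "finite {W. local_resolving_set G W}"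
    by (rule finite_subset[of _ "Pow (verts G)"]) (auto simp: local_resolving_set_def)
  then show "finite (card ` {W. local_resolving_set G W})" by simp
qed (use assms in auto)

lemma connected_K4_free_neighbours:
  assumes "connected G" "4 \<le> card (verts G)" "clique_number G < 4"
  shows "connected_K4_free (verts G) neighbours"
proof
  fix a b c d
  assume adj: "b \<in> neighbours a" "c \<in> neighbours a" "d \<in> neighbours a"
    "c \<in> neighbours b" "d \<in> neighbours b" "d \<in> neighbours c"
  have "card {a, b, c, d} \<le> clique_number G"
  proof (rule card_clique_le_clique_number)
    show "{a, b, c, d} \<subseteq> verts G"
      using adj[THEN neighbours_sym] adj neighbours_subset by blast
    show "u \<rightarrow> v" if "u \<in> {a, b, c, d}" "v \<in> {a, b, c, d}" "u \<noteq> v" for u v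
      using that adj adj[THEN neighbours_sym] unfolding neighbours_def by auto
  qed
  moreover have "card {a, b, c, d} = 4"
    using adj neighbours_irrefl by (auto simp: card_insert_if)
  ultimately show False using assms(3) by simp
qed (use assms neighbours_sym neighbours_irrefl neighbours_subset edge_leaving_if_connected
  in \<open>auto\<close>)

end

theorem theorem3:
  fixes G :: "('a,'b) pre_digraph"
  assumes "graph G"
    and "Digraph_Component.connected G"
    and "card (verts G) \<ge> 4"
    and "clique_number G < 4"
  shows "local_metric_dimension G \<le> card (verts G) div 2"
proof -
  interpret graph G by (rule assms(1))
  interpret K: connected_K4_free "verts G" neighbours
    using assms(2-4) by (rule connected_K4_free_neighbours)
  obtain W where W: "K.resolving W" "2 * card W \<le> card (verts G)"
    using K.ex_small_resolving by blast
  have "local_resolving_set G W"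
    using assms(2) W(1) by (intro local_resolving_setI) (auto simp: K.resolving_def)
  then have "local_metric_dimension G \<le> card W" by (rule local_metric_dimension_le)
  also have "\<dots> \<le> card (verts G) div 2" using W(2) by simp
  finally show ?thesis .
qed

end
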